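(* Let $T(\mathbf{x})$, $\mathbf{x}\in\mathbb{S}^2$, be an anisotropic spherical random field with covariance function $C$. Then $C$ is not rotationally invariant; that is, it is not the case that for every pair of points $\mathbf{x}_0,\mathbf{x}_0'\in\mathbb{S}^2$ there exists a rotation $\rho\in SO(3)$ with $\rho\mathbf{x}_0=\mathbf{x}_0'$ and $C(\mathbf{x}_0,\mathbf{x})=C(\rho\mathbf{x}_0,\rho\mathbf{x})$ for all $\mathbf{x}\in\mathbb{S}^2$.
   Context: $\mathbb{S}^2$ is the unit sphere in $\mathbb{R}^3$. Standing assumptions: a spherical random field is a real-valued second-order random field $T$ on $\mathbb{S}^2$ with zero mean whose covariance function $C(\mathbf{x}_1,\mathbf{x}_2)=\mathbf{E}(T(\mathbf{x}_1)T(\mathbf{x}_2))$ is continuous on $\mathbb{S}^2\times\mathbb{S}^2$ and not identically constant. The field is isotropic if $C(\rho\mathbf{x}_1,\rho\mathbf{x}_2)=C(\mathbf{x}_1,\mathbf{x}_2)$ for all $\rho\in SO(3)$ and all $\mathbf{x}_1,\mathbf{x}_2\in\mathbb{S}^2$; equivalently $C(\mathbf{x}_1,\mathbf{x}_2)=B(\gamma(\mathbf{x}_1,\mathbf{x}_2))$ for some $B:[0,\pi]\to\mathbb{R}$, where $\gamma$ is the great-circle (angular) distance. It is anisotropic if it is not isotropic. Rotational invariance of the covariance function means: for all $\mathbf{x}_0,\mathbf{x}_0'\in\mathbb{S}^2$ there is $\rho\in SO(3)$ (possibly depending on $\mathbf{x}_0,\mathbf{x}_0'$) with $\rho\mathbf{x}_0=\mathbf{x}_0'$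 and $C(\mathbf{x}_0,\mathbf{x})=C(\rho\mathbf{x}_0,\rho\mathbf{x})$ for all $\mathbf{x}\in\mathbb{S}^2$. *)

theory Defs
  imports "HOL-Probability.Probability"
begin

abbreviation S2 :: "(real ^ 3) set" where
  "S2 \<equiv> sphere 0 1"

definition SO3 :: "(real ^ 3 ^ 3) set" where
  "SO3 = {R. rotation_matrix R}"

text \<open>A field is indexed by all of \<open>real ^ 3\<close>, but every condition below only looks at
  its values at points of the unit sphere.\<close>

definition covariance_function ::
    "'w measure \<Rightarrow> (real ^ 3 \<Rightarrow> 'w \<Rightarrow> real) \<Rightarrow> real ^ 3 \<Rightarrow> real ^ 3 \<Rightarrow> real" where
  "covariance_function M T x y = (\<integral>w. T x w * T y w \<partial>M)"

locale spherical_random_field = prob_space M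
  for M :: "'w measure" and T :: "real ^ 3 \<Rightarrow> 'w \<Rightarrow> real" +
  assumes random_variable_field: "\<And>x. x \<in> S2 \<Longrightarrow> random_variable borel (T x)"
    and second_order: "\<And>x. x \<in> S2 \<Longrightarrow> integrable M (\<lambda>w. (T x w)\<^sup>2)"
    and zero_mean: "\<And>x. x \<in> S2 \<Longrightarrow> expectation (T x) = 0"
    and continuous_covariance:
      "continuous_on (S2 \<times> S2) (\<lambda>(x, y). covariance_function M T x y)"
    and nonconstant_covariance:
      "\<not> (\<exists>c. \<forall>x\<in>S2. \<forall>y\<in>S2. covariance_function M T x y = c)"

definition isotropic :: "'w measure \<Rightarrow> (real ^ 3 \<Rightarrow> 'w \<Rightarrow> real) \<Rightarrow> bool" where
  "isotropic M T \<longleftrightarrow>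
     (\<forall>R\<in>SO3. \<forall>x\<in>S2. \<forall>y\<in>S2.
        covariance_function M T (R *v x) (R *v y) = covariance_function M T x y)"

abbreviation anisotropic :: "'w measure \<Rightarrow> (real ^ 3 \<Rightarrow> 'w \<Rightarrow> real) \<Rightarrow> bool" where
  "anisotropic M T \<equiv> \<not> isotropic M T"

text \<open>Unlike in isotropy, the rotation is chosen after the pair of points, and one argument
  of the kernel stays at the first of these points.\<close>

definition rotationally_invariant :: "(real ^ 3 \<Rightarrow> real ^ 3 \<Rightarrow> real) \<Rightarrow> bool" where
  "rotationally_invariant C \<longleftrightarrow>
     (\<forall>x0\<in>S2. \<forall>x0'\<in>S2. \<exists>R\<in>SO3.
        R *v x0 = x0' \<and> (\<forall>x\<in>S2. C x0 x = C (R *v x0) (R *v x)))"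

end

theory Submission
  imports Defs
begin

text \<open>
  For a unit vector \<open>x\<close> and a unit tangent vector \<open>e\<close> at \<open>x\<close>, the function \<open>C x\<close> restricted to a
  circle of latitude about \<open>x\<close> has Fourier coefficients with respect to the frame
  \<open>(e, x \<times> e)\<close>. Turning \<open>e\<close> by an angle multiplies the \<open>m\<close>-th coefficient by a unit complex
  number, so rotational invariance forces its modulus to be the same at all points of the sphere.
  If it were nonzero for some \<open>m > 0\<close>, it would give nonvanishing continuous functions on both
  closed hemispheres (each carrying a continuous frame) that differ by \<open>\<plusminus> z ^ (2 * m)\<close> on
  the equator, which has nonzero winding number; this is the hairy ball argument for \<open>m\<close>-fold
  direction fields. So all these coefficients vanish, \<open>C x\<close> is constant on circles of latitude
  about \<open>x\<close>, and the choice of the rotation taking \<open>x\<close> to a given point becomes irrelevant.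
\<close>

section \<open>Winding number obstruction on the closed disc\<close>

text \<open>The quotient \<open>f / g\<close> has a continuous logarithm on the whole disc. On the
  boundary circle that logarithm would have to grow like \<open>\<i> * n * t\<close>, which does not
  close up after a full turn.\<close>

lemma power_not_nonvanishing_extension:
  fixes f g :: "complex \<Rightarrow> complex"
  assumes f: "continuous_on (cball 0 1) f" "\<And>z. z \<in> cball 0 1 \<Longrightarrow> f z \<noteq> 0"
    and g: "continuous_on (cball 0 1) g" "\<And>z. z \<in> cball 0 1 \<Longrightarrow> g z \<noteq> 0"
    and eq: "\<And>z. norm z = 1 \<Longrightarrow> f z = k * z ^ n * g z"
    and n: "n > 0"
  shows False
proof -
  have "continuous_on (cball 0 1) (\<lambda>z. f z / g z)"
    using f g by (intro continuous_intros) auto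
  moreover have "f z / g z \<noteq> 0" if "z \<in> cball 0 1" for z
    using f(2)[OF that] g(2)[OF that] by simp
  ultimately obtain h where h: "continuous_on (cball 0 1) h"
      "\<And>z. z \<in> cball 0 1 \<Longrightarrow> f z / g z = exp (h z)"
    using continuous_logarithm_on_cball by blast
  have k: "exp (h (cis t) - \<i> * of_real (n * t)) = k" for t :: real
  proof -
    have "exp (h (cis t)) = f (cis t) / g (cis t)"
      using h(2)[of "cis t"] by simp
    also have "\<dots> = k * cis t ^ n"
      using eq[of "cis t"] g(2)[of "cis t"] by simp
    also have "cis t ^ n = exp (\<i> * of_real (n * t))"
      by (simp only: Complex.DeMoivre cis_conv_exp[of "real n * t"])
    finally show ?thesis by (simp add: exp_diff)
  qed
  let ?q = "\<lambda>t::real. h (cis t) - \<i> * of_real (n * t)"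
  \<comment> \<open>All values of \<open>?q\<close> are logarithms of the same number
    \<open>k\<close>, so distinct values are at least 2 * pi apart, and continuity leaves only one
    value.\<close>
  have "?q constant_on UNIV"
  proof (rule continuous_discrete_range_constant)
    show "continuous_on UNIV ?q"
      by (intro continuous_intros continuous_on_compose2[OF h(1)]) auto
    fix t :: real
    show "\<exists>e>0. \<forall>s. s \<in> UNIV \<and> ?q s \<noteq> ?q t \<longrightarrow> e \<le> norm (?q s - ?q t)"
    proof (intro exI[of _ "2 * pi"] conjI allI impI)
      fix s assume "s \<in> UNIV \<and> ?q s \<noteq> ?q t"
      then have ne: "?q s \<noteq> ?q t" by simp
      have "exp (?q s) = exp (?q t)" by (simp only: k)
      then obtain j :: int where j: "?q s = ?q t + (of_int (2 * j) * pi) * \<i>"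
        using exp_eq by metis
      with ne have "j \<noteq> 0" by auto
      then have "1 \<le> \<bar>real_of_int j\<bar>" by linarith
      moreover have "norm (?q s - ?q t) = 2 * pi * \<bar>real_of_int j\<bar>"
        unfolding j by (simp add: norm_mult)
      ultimately show "2 * pi \<le> norm (?q s - ?q t)" by simp
    qed auto
  qed auto
  \<comment> \<open>The term \<open>h (cis t)\<close> agrees at both ends, while
    \<open>n * t\<close> changes by 2 * pi * n.\<close>
  then have "?q 0 = ?q (2 * pi)" unfolding constant_on_def by (metis UNIV_I)
  with n show False by simp
qed

section \<open>Fourier coefficients on the unit circle\<close>

definition circle_integral :: "(complex \<Rightarrow> complex) \<Rightarrow> complex" where
  "circle_integral h = integral {0..2 * pi} (\<lambda>t. h (cis t))"

lemma circle_integrable: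
  fixes h :: "complex \<Rightarrow> 'a::banach"
  assumes "continuous_on (sphere 0 1) h"
  shows "(\<lambda>t. h (cis t)) integrable_on {a..b}"
  by (intro integrable_continuous_real continuous_on_compose2[OF assms] continuous_intros) auto

lemma circle_integral_cong:
  assumes "\<And>w. norm w = 1 \<Longrightarrow> f w = g w"
  shows "circle_integral f = circle_integral g"
  unfolding circle_integral_def using assms by (auto intro: Henstock_Kurzweil_Integration.integral_cong)

lemma circle_integral_of_real:
  assumes "continuous_on (sphere 0 1) r"
  shows "circle_integral (\<lambda>w. of_real (r w)) = of_real (integral {0..2 * pi} (\<lambda>t. r (cis t)))"
  using integral_linear[OF circle_integrable[OF assms] bounded_linear_of_real]
  by (simp add: circle_integral_def o_def)

lemma circle_integral_add:
  assumes "continuous_on (sphere 0 1) f" "continuous_on (sphere 0 1) g"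
  shows "circle_integral (\<lambda>w. f w + g w) = circle_integral f + circle_integral g"
  unfolding circle_integral_def
  using assms by (intro Henstock_Kurzweil_Integration.integral_add circle_integrable)

lemma circle_integral_mult_left: "circle_integral (\<lambda>w. c * f w) = c * circle_integral f"
  unfolding circle_integral_def by (rule Henstock_Kurzweil_Integration.integral_mult_right)

text \<open>Rotation shifts the angle by \<open>a\<close>; by periodicity the part of the shifted
  interval beyond 2 * pi can be moved back to the start.\<close>

lemma circle_integral_rotate:
  assumes h: "continuous_on (sphere 0 1) h" and \<zeta>: "norm \<zeta> = 1"
  shows "circle_integral (\<lambda>w. h (w * \<zeta>)) = circle_integral h"
proof -
  obtain a where a: "0 \<le> a" "a < 2 * pi" and \<zeta>a: "\<zeta> = cis a"
    using complex_unit_circle[of \<zeta>] sincos_total_2pi[of "Re \<zeta>" "Im \<zeta>"] \<zeta>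
    by (metis cis.code complex_surj cmod_power2 one_power2)
  let ?g = "\<lambda>t. h (cis t)"
  have int: "?g integrable_on {x..y}" for x y using circle_integrable[OF h] .
  have cont: "continuous_on {x..y} ?g" for x y
    by (intro continuous_on_compose2[OF h] continuous_intros) auto
  have per: "?g \<circ> (+) (2 * pi) = ?g" by (auto simp: fun_eq_iff cis_mult[symmetric])
  have "circle_integral (\<lambda>w. h (w * \<zeta>)) = integral {0..2 * pi} (?g \<circ> (+) a)"
    unfolding circle_integral_def by (simp add: \<zeta>a cis_mult add.commute o_def)
  also have "\<dots> = integral {a..2 * pi + a} ?g"
    using integral_shift_Icc_real[of 0 "2*pi" ?g a] by simp
  also have "\<dots> = integral {a..2 * pi} ?g + integral {2 * pi..2 * pi + a} ?g"
    using a int by (intro Henstock_Kurzweil_Integration.integral_combine[symmetric]) auto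
  also have "integral {2 * pi..2 * pi + a} ?g = integral {0..a} (?g \<circ> (+) (2 * pi))"
    using integral_shift_Icc_real[of 0 a ?g "2*pi"] by (simp add: add.commute)
  also have "integral {a..2 * pi} ?g + \<dots> = integral {0..2 * pi} ?g"
    unfolding per using a int Henstock_Kurzweil_Integration.integral_combine[of 0 a "2*pi" ?g]
    by (simp add: add.commute)
  finally show ?thesis by (simp add: circle_integral_def)
qed

lemma continuous_on_powi_sphere [continuous_intros]:
  "continuous_on (sphere 0 1) (\<lambda>w::complex. w powi m)"
  by (intro continuous_intros) auto

lemma circle_integral_powi:
  assumes "m \<noteq> 0"
  shows "circle_integral (\<lambda>w. w powi m) = 0"
proof -
  \<comment> \<open>rotating by this angle changes the sign of the integrand\<close>
  define \<zeta> where "\<zeta> = cis (pi / of_int m)"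
  have z: "\<zeta> powi m = -1"
    using assms by (simp add: \<zeta>_def cis_power_int)
  have "circle_integral (\<lambda>w. w powi m) = circle_integral (\<lambda>w. (w * \<zeta>) powi m)"
    by (rule circle_integral_rotate[symmetric]) (auto intro: continuous_intros simp: \<zeta>_def)
  also have "\<dots> = circle_integral (\<lambda>w. \<zeta> powi m * w powi m)"
    by (simp add: power_int_mult_distrib mult.commute)
  also have "\<dots> = - circle_integral (\<lambda>w. w powi m)"
    unfolding circle_integral_mult_left z by simp
  finally show ?thesis by simp
qed

lemma inverse_eq_cnj_if_norm_1:
  assumes "norm w = 1"
  shows "inverse w = cnj w"
  by (rule inverse_unique) (simp add: assms flip: complex_norm_square)

text \<open>A real linear function on the circle has the form \<open>A * w + B * w powi (-1)\<close>, so multiplying by it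
  only shifts Fourier coefficients. Quantifying over \<open>h\<close> makes the product case of the induction
  two applications of the hypothesis.\<close>

lemma circle_integral_times_polynomial:
  fixes p :: "complex \<Rightarrow> real"
  assumes "real_polynomial_function p"
    and "continuous_on (sphere 0 1) h"
    and "\<And>m. circle_integral (\<lambda>w. h w * w powi m) = 0"
  shows "circle_integral (\<lambda>w. of_real (p w) * h w * w powi m) = 0"
  using assms
proof (induction p arbitrary: h m rule: real_polynomial_function.induct)
  case (linear f)
  \<comment> \<open>On the circle \<open>cnj w\<close> is the inverse of \<open>w\<close>, so Re w =
    (w + 1/w) / 2 and Im w = (w - 1/w) / (2i); collecting terms gives \<open>?A\<close> and
    \<open>?B\<close>.\<close>
  let ?A = "(of_real (f 1) - \<i> * of_real (f \<i>)) / 2"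
  let ?B = "(of_real (f 1) + \<i> * of_real (f \<i>)) / 2"
  have f: "complex_of_real (f w) = ?A * w + ?B * w powi (-1)" if w: "norm w = 1" for w
  proof -
    have "f w = f (Re w *\<^sub>R 1 + Im w *\<^sub>R \<i>)"
      by (intro arg_cong[of _ _ f]) (simp add: complex_eq_iff)
    also have "\<dots> = Re w * f 1 + Im w * f \<i>"
      using linear.hyps by (simp add: bounded_linear.linear linear_add linear_scale)
    finally have fw: "f w = Re w * f 1 + Im w * f \<i>" .
    have "w powi (-1) = cnj w"
      using w by (simp add: power_int_minus inverse_eq_cnj_if_norm_1)
    then show ?thesis unfolding fw by (simp only:) (simp add: complex_eq_iff field_simps)
  qed
  have "circle_integral (\<lambda>w. of_real (f w) * h w * w powi m)
      = circle_integral (\<lambda>w. ?A * (h w * w powi (m + 1)) + ?B * (h w * w powi (m - 1)))"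
  proof (rule circle_integral_cong)
    fix w :: complex assume w: "norm w = 1"
    then have "w \<noteq> 0" by auto
    then show "of_real (f w) * h w * w powi m
        = ?A * (h w * w powi (m + 1)) + ?B * (h w * w powi (m - 1))"
      unfolding f[OF w] by (simp add: power_int_add power_int_diff power_int_minus field_simps)
  qed
  also have "\<dots> = ?A * circle_integral (\<lambda>w. h w * w powi (m + 1))
      + ?B * circle_integral (\<lambda>w. h w * w powi (m - 1))"
    using linear.prems(1)
    by (subst circle_integral_add) (auto intro!: continuous_intros simp only: circle_integral_mult_left)
  finally show ?case using linear.prems(2) by simp
next
  case (const c)
  then show ?case by (simp add: mult.assoc circle_integral_mult_left)
next
  case (add f g)
  have "continuous_on (sphere 0 1) f" "continuous_on (sphere 0 1) g"
    using add.hyps by (simp_all add: continuous_on_polymonial_function real_polynomial_function_eq)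
  then show ?case
    using add by (simp add: algebra_simps) (subst circle_integral_add; auto intro!: continuous_intros simp: algebra_simps)
next
  case (mult f g)
  have g: "continuous_on (sphere 0 1) g"
    using mult.hyps by (simp_all add: continuous_on_polymonial_function real_polynomial_function_eq)
  have "circle_integral (\<lambda>w. of_real (f w) * (of_real (g w) * h w) * w powi m) = 0"
    by (rule mult.IH(1)) (use mult g in \<open>auto intro!: continuous_intros\<close>)
  then show ?case by (simp add: mult_ac)
qed

lemma circle_integral_cnj: "circle_integral (\<lambda>w. cnj (f w)) = cnj (circle_integral f)"
  unfolding circle_integral_def by (rule integral_cnj[symmetric])

text \<open>After subtraction of the mean, the function is orthogonal to all real polynomials.
  Approximating it by these (Stone-Weierstrass) makes its square integrate to 0.\<close>

lemma constant_on_circle_if_fourier_vanish: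
  fixes v :: "complex \<Rightarrow> real"
  assumes v: "continuous_on (sphere 0 1) v"
    and F: "\<And>m::nat. m > 0 \<Longrightarrow> circle_integral (\<lambda>w. of_real (v w) * w ^ m) = 0"
  shows "v constant_on sphere 0 1"
proof -
  define \<mu> where "\<mu> = integral {0..2 * pi} (\<lambda>t. v (cis t)) / (2 * pi)"
  define u where "u = (\<lambda>w. v w - \<mu>)"
  have u: "continuous_on (sphere 0 1) u" unfolding u_def by (intro continuous_intros v)
  have Fv: "circle_integral (\<lambda>w. of_real (v w) * w powi m) = 0" if "m \<noteq> 0" for m
  proof (cases "m > 0")
    case True
    then show ?thesis using F[of "nat m"] by (simp add: power_int_def)
  next
    \<comment> \<open>As \<open>v\<close> is real, coefficients of negative index are conjugates of
      those of positive index.\<close>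
    case False
    have "circle_integral (\<lambda>w. of_real (v w) * w powi m) =
        circle_integral (\<lambda>w. cnj (of_real (v w) * w ^ nat (-m)))"
      using False that by (intro circle_integral_cong) (auto simp: power_int_def inverse_eq_cnj_if_norm_1)
    then show ?thesis using F[of "nat (-m)"] False that by (simp only: circle_integral_cnj) simp
  qed
  have Fu: "circle_integral (\<lambda>w. of_real (u w) * w powi m) = 0" for m
  proof (cases "m = 0")
    case True
    have "integral {0..2 * pi} (\<lambda>t. u (cis t)) = 0"
      unfolding u_def using circle_integrable[OF v]
      by (subst Henstock_Kurzweil_Integration.integral_diff) (auto simp: \<mu>_def)
    then show ?thesis using True by (simp add: circle_integral_of_real[OF u])
  next
    case False
    have "circle_integral (\<lambda>w. of_real (u w) * w powi m)
      = circle_integral (\<lambda>w. of_real (v w) * w powi m + (- of_real \<mu>) * w powi m)"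
      by (simp add: u_def algebra_simps)
    also have "\<dots> = 0"
      using v by (subst circle_integral_add)
        (auto intro!: continuous_intros
          simp only: circle_integral_mult_left circle_integral_powi[OF False] Fv[OF False] mult_zero_right add_0)
    finally show ?thesis .
  qed
  have poly: "integral {0..2 * pi} (\<lambda>t. p (cis t) * u (cis t)) = 0"
    if p: "real_polynomial_function p" for p :: "complex \<Rightarrow> real"
  proof -
    have "continuous_on (sphere 0 1) (\<lambda>w. p w * u w)"
      by (intro continuous_intros u continuous_on_polymonial_function p[unfolded real_polynomial_function_eq])
    from circle_integral_of_real[OF this]
    have "complex_of_real (integral {0..2 * pi} (\<lambda>t. p (cis t) * u (cis t))) =
       circle_integral (\<lambda>w. of_real (p w) * of_real (u w) * w powi 0)"
      by simp
    also have "\<dots> = 0"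
      by (rule circle_integral_times_polynomial[OF p _ Fu]) (intro continuous_intros u)
    finally show ?thesis by simp
  qed
  have "compact (u ` sphere 0 1)" by (intro compact_continuous_image u compact_sphere)
  then obtain B where B: "\<And>w. w \<in> sphere 0 1 \<Longrightarrow> \<bar>u w\<bar> \<le> B" "B > 0"
    using compact_imp_bounded bounded_pos by (metis image_eqI real_norm_def)
  let ?I = "integral {0..2 * pi} (\<lambda>t. (u (cis t))\<^sup>2)"
  have small: "?I \<le> e" if e: "e > 0" for e
  proof -
    \<comment> \<open>Chosen so that the error bound \<open>d * B\<close>, integrated over an
      interval of length 2 * pi, is exactly \<open>e\<close>.\<close>
    define d where "d = e / (2 * pi * B)"
    have d: "d > 0" using e B by (simp add: d_def)
    obtain p where p: "real_polynomial_function p" and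
      pd: "\<And>w. w \<in> sphere 0 1 \<Longrightarrow> \<bar>u w - p w\<bar> < d"
      using Stone_Weierstrass_real_polynomial_function[OF compact_sphere u d] by blast
    note cp = continuous_on_polymonial_function[OF p[unfolded real_polynomial_function_eq], of "sphere 0 1"]
    have i1: "(\<lambda>t. (u (cis t))\<^sup>2) integrable_on {0..2*pi}"
      by (rule circle_integrable[of "\<lambda>w. (u w)\<^sup>2"]) (intro continuous_intros u)
    have i2: "(\<lambda>t. p (cis t) * u (cis t)) integrable_on {0..2*pi}"
      by (rule circle_integrable[of "\<lambda>w. p w * u w"]) (intro continuous_intros u cp)
    have "?I = integral {0..2 * pi} (\<lambda>t. (u (cis t))\<^sup>2 - p (cis t) * u (cis t))"
      using poly[OF p] by (simp add: Henstock_Kurzweil_Integration.integral_diff i1 i2)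
    also have "\<dots> \<le> integral {0..2 * pi} (\<lambda>t. d * B)"
    proof (rule integral_le)
      fix t
      have "(u (cis t))\<^sup>2 - p (cis t) * u (cis t) = (u (cis t) - p (cis t)) * u (cis t)"
        by (simp add: power2_eq_square algebra_simps)
      also have "\<dots> \<le> \<bar>u (cis t) - p (cis t)\<bar> * \<bar>u (cis t)\<bar>"
        by (metis abs_ge_self abs_mult)
      also have "\<dots> \<le> d * B"
        using pd[of "cis t"] B(1)[of "cis t"] d by (intro mult_mono) auto
      finally show "(u (cis t))\<^sup>2 - p (cis t) * u (cis t) \<le> d * B" .
    qed (use i1 i2 in \<open>auto intro: Henstock_Kurzweil_Integration.integrable_diff\<close>)
    also have "\<dots> = e" using B by (simp add: d_def)
    finally show ?thesis .
  qed
  have cu: "continuous_on {0..2 * pi} (\<lambda>t. (u (cis t))\<^sup>2)"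
    by (intro continuous_intros continuous_on_compose2[OF u]) auto
  have "?I \<le> 0" using small field_le_epsilon[of ?I 0] by simp
  moreover have "?I \<ge> 0" using cu
    by (intro Henstock_Kurzweil_Integration.integral_nonneg integrable_continuous_real) auto
  ultimately have "\<forall>t\<in>{0..2 * pi}. (u (cis t))\<^sup>2 = 0"
    using integral_eq_0_iff[OF cu] by auto
  then have "u (cis t) = 0" if "t \<in> {0..2*pi}" for t using that by simp
  moreover have "\<exists>t\<in>{0..2*pi}. w = cis t" if "norm w = 1" for w
    using sincos_total_2pi[of "Re w" "Im w"] that
    by (metis atLeastAtMost_iff cis.code complex_surj cmod_power2 less_imp_le one_power2)
  ultimately have "v w = \<mu>" if "w \<in> sphere 0 1" for w
    using that unfolding u_def by fastforce
  then show ?thesis unfolding constant_on_def by blast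
qed

section \<open>Tangent frames and circles of latitude\<close>

definition unit_tangent :: "real ^ 3 \<Rightarrow> real ^ 3 \<Rightarrow> bool" where
  "unit_tangent x e \<longleftrightarrow> norm x = 1 \<and> norm e = 1 \<and> x \<bullet> e = 0"

text \<open>The tangent plane at \<open>x\<close> is identified with the complex numbers through the
  frame \<open>(e, x \<times> e)\<close>, so that turning the frame becomes complex
  multiplication.\<close>

definition tangent :: "real ^ 3 \<Rightarrow> real ^ 3 \<Rightarrow> complex \<Rightarrow> real ^ 3" where
  "tangent x e \<zeta> = Re \<zeta> *\<^sub>R e + Im \<zeta> *\<^sub>R cross3 x e"

text \<open>Here \<open>a\<close> is the cosine of the angular distance from the pole
  \<open>x\<close>, and a unit complex number \<open>w\<close> serves as longitude, counted from
  \<open>e\<close>.\<close>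

definition latitude :: "real \<Rightarrow> real ^ 3 \<Rightarrow> real ^ 3 \<Rightarrow> complex \<Rightarrow> real ^ 3" where
  "latitude a x e w = a *\<^sub>R x + sqrt (1 - a\<^sup>2) *\<^sub>R tangent x e w"

context
  fixes x e :: "real ^ 3"
  assumes xe: "unit_tangent x e"
begin

lemma unit_tangent_inner:
  "x \<bullet> x = 1" "e \<bullet> e = 1" "x \<bullet> e = 0" "e \<bullet> x = 0"
  "x \<bullet> cross3 x e = 0" "cross3 x e \<bullet> x = 0" "e \<bullet> cross3 x e = 0" "cross3 x e \<bullet> e = 0"
  "cross3 x e \<bullet> cross3 x e = 1"
  using xe by (auto simp: unit_tangent_def dot_cross_self dot_cross inner_commute norm_eq_1)

lemma cross3_cross3_unit_tangent: "cross3 x (cross3 x e) = - e"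
  by (simp add: Lagrange unit_tangent_inner)

lemma unit_tangent_rotate:
  assumes "norm \<zeta> = 1"
  shows "unit_tangent x (tangent x e \<zeta>)"
proof -
  have "(Re \<zeta>)\<^sup>2 + (Im \<zeta>)\<^sup>2 = 1" using assms by (simp flip: cmod_power2)
  with xe show ?thesis
    by (simp add: unit_tangent_def norm_eq_1 tangent_def inner_simps unit_tangent_inner
        flip: power2_eq_square)
qed

lemma tangent_tangent: "tangent x (tangent x e \<zeta>) w = tangent x e (w * \<zeta>)"
  by (simp add: tangent_def cross_add_right cross_mult_right cross3_cross3_unit_tangent algebra_simps)

lemma latitude_tangent: "latitude a x (tangent x e \<zeta>) w = latitude a x e (w * \<zeta>)"
  by (simp add: latitude_def tangent_tangent)

lemma latitude_in_S2:
  assumes "\<bar>a\<bar> \<le> 1" "norm w = 1"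
  shows "latitude a x e w \<in> S2"
proof -
  have "a\<^sup>2 \<le> 1" using assms(1) by (simp add: abs_square_le_1)
  moreover have "(Re w)\<^sup>2 + (Im w)\<^sup>2 = 1" using assms(2) by (simp flip: cmod_power2)
  moreover have "latitude a x e w \<bullet> latitude a x e w
      = a\<^sup>2 + (sqrt (1 - a\<^sup>2))\<^sup>2 * ((Re w)\<^sup>2 + (Im w)\<^sup>2)"
    by (simp add: latitude_def tangent_def inner_simps unit_tangent_inner power2_eq_square algebra_simps)
  ultimately show ?thesis by (simp add: norm_eq_1)
qed

lemma unit_tangent_expansion:
  "y = (x \<bullet> y) *\<^sub>R x + (e \<bullet> y) *\<^sub>R e + (cross3 x e \<bullet> y) *\<^sub>R cross3 x e" (is "y = ?s")
proof -
  let ?z = "y - ?s"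
  have z: "?z \<bullet> x = 0" "?z \<bullet> e = 0" "?z \<bullet> cross3 x e = 0"
    by (simp_all add: inner_simps unit_tangent_inner inner_commute)
  \<comment> \<open>Both the inner and the cross product of \<open>?z\<close> with the unit vector
    \<open>cross3 x e\<close> vanish, which forces \<open>?z\<close> to be 0.\<close>
  have "cross3 ?z (cross3 x e) = 0" by (simp add: Lagrange z)
  with norm_cross_dot[of ?z "cross3 x e"] z(3) have "norm ?z * norm (cross3 x e) = 0" by simp
  moreover have "norm (cross3 x e) = 1" by (simp add: norm_eq_1 unit_tangent_inner)
  ultimately show ?thesis by simp
qed

lemma in_latitude:
  assumes y: "y \<in> S2"
  obtains w where "norm w = 1" "y = latitude (x \<bullet> y) x e w"
proof -
  define a b c where "a = x \<bullet> y" and "b = e \<bullet> y" and "c = cross3 x e \<bullet> y"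
  have ye: "y = a *\<^sub>R x + b *\<^sub>R e + c *\<^sub>R cross3 x e"
    unfolding a_def b_def c_def by (rule unit_tangent_expansion)
  have "y \<bullet> y = a\<^sup>2 + b\<^sup>2 + c\<^sup>2"
    by (subst (1 2) ye) (simp add: inner_simps unit_tangent_inner power2_eq_square)
  with y have sq: "a\<^sup>2 + b\<^sup>2 + c\<^sup>2 = 1" by (simp add: norm_eq_1)
  define s where "s = sqrt (1 - a\<^sup>2)"
  have s: "s\<^sup>2 = b\<^sup>2 + c\<^sup>2" using sq zero_le_power2[of b] zero_le_power2[of c]
    unfolding s_def by (subst real_sqrt_pow2) linarith+
  show ?thesis
  proof (cases "s = 0")
    case True
    then have "b = 0" "c = 0" using s by (auto simp: sum_power2_eq_zero_iff)
    \<comment> \<open>At the poles \<open>x\<close> and \<open>- x\<close> the circle shrinks to a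
      point and any unit \<open>w\<close> would do.\<close>
    then show ?thesis using that[of 1] ye True unfolding s_def a_def latitude_def by simp
  next
    case False
    have "(b / s)\<^sup>2 + (c / s)\<^sup>2 = 1"
      using False by (simp add: power_divide flip: add_divide_distrib s)
    then have "norm (Complex (b / s) (c / s)) = 1" by (simp add: cmod_def)
    moreover have "y = latitude (x \<bullet> y) x e (Complex (b / s) (c / s))"
      unfolding latitude_def tangent_def a_def[symmetric] s_def[symmetric]
      using False by (subst ye) (simp add: algebra_simps)
    ultimately show ?thesis using that by blast
  qed
qed

end

text \<open>Being orthogonal to \<open>x\<close>, the vector \<open>f\<close> lies on the latitude
  of height 0, where \<open>latitude\<close> and \<open>tangent\<close> coincide.\<close>

lemma ex_unit_tangent_rotation:
  assumes "unit_tangent x e" "unit_tangent x f"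
  obtains \<zeta> where "norm \<zeta> = 1" "f = tangent x e \<zeta>"
proof -
  have f: "f \<in> S2" "x \<bullet> f = 0" using assms by (auto simp: unit_tangent_def)
  from in_latitude[OF assms(1) f(1)] show ?thesis
    using that f(2) by (auto simp: latitude_def)
qed

lemma inner_rotation:
  assumes "R \<in> SO3"
  shows "(R *v x) \<bullet> (R *v y) = x \<bullet> y"
  using assms orthogonal_transformation_matrix[of "(*v) R"]
  by (simp add: SO3_def rotation_matrix_def orthogonal_transformation_def)

lemma unit_tangent_rotation:
  assumes "R \<in> SO3" "unit_tangent x e"
  shows "unit_tangent (R *v x) (R *v e)"
  using assms(2) by (simp add: unit_tangent_def norm_eq_1 inner_rotation[OF assms(1)])

text \<open>Rotations preserve the cross product; an orthogonal map of determinant -1 would reverse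
  the longitude.\<close>

lemma latitude_rotation:
  assumes "R \<in> SO3"
  shows "R *v latitude a x e w = latitude a (R *v x) (R *v e) w"
  using assms
  by (simp add: SO3_def latitude_def tangent_def cross_rotation_matrix
      matrix_vector_right_distrib matrix_vector_mult_scaleR)

section \<open>Continuous frames on the two closed hemispheres\<close>

definition hemisphere :: "real \<Rightarrow> complex \<Rightarrow> real ^ 3" where
  "hemisphere s z = vector [Re z, Im z, s * sqrt (1 - (norm z)\<^sup>2)]"

text \<open>The parallel transport of \<open>(1, 0, 0)\<close> along the great circles through the pole \<open>(0, 0, s)\<close>,
  for \<open>s = \<plusminus>1\<close>.\<close>

definition hemisphere_tangent :: "real \<Rightarrow> complex \<Rightarrow> real ^ 3" where
  "hemisphere_tangent s z =
     (let c = 1 + sqrt (1 - (norm z)\<^sup>2)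
      in vector [1 - (Re z)\<^sup>2 / c, - Re z * Im z / c, - s * Re z])"

lemma unit_tangent_hemisphere:
  assumes s: "s\<^sup>2 = 1" and z: "norm z \<le> 1"
  shows "unit_tangent (hemisphere s z) (hemisphere_tangent s z)"
proof -
  define a b c where "a = Re z" and "b = Im z" and "c = sqrt (1 - (norm z)\<^sup>2)"
  have c: "c \<ge> 0" "c\<^sup>2 = 1 - (norm z)\<^sup>2"
    using z by (simp_all add: c_def abs_square_le_1)
  moreover have "a\<^sup>2 + b\<^sup>2 = (norm z)\<^sup>2" by (simp add: cmod_power2 a_def b_def)
  ultimately have abc: "a\<^sup>2 + b\<^sup>2 = (1 - c) * (1 + c)"
    by (simp add: algebra_simps power2_eq_square)
  \<comment> \<open>Since \<open>a\<^sup>2 + b\<^sup>2\<close> factors as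
    \<open>(1 - c) * (1 + c)\<close>, this substitution clears the denominator of the tangent
    field.\<close>
  define d where "d = a / (1 + c)"
  have ad: "a = d * (1 + c)" using c by (simp add: d_def)
  have x: "hemisphere s z = vector [a, b, s * c]"
    by (simp add: hemisphere_def a_def b_def c_def)
  have e: "hemisphere_tangent s z = vector [1 - a * d, - d * b, - s * a]"
    by (simp add: hemisphere_tangent_def a_def b_def c_def d_def Let_def power2_eq_square)
  have ss: "s * (s * t) = t" for t using s by (simp add: power2_eq_square flip: mult.assoc)
  have d2: "d * (a\<^sup>2 + b\<^sup>2) = a * (1 - c)"
    unfolding abc by (simp add: ad algebra_simps)
  have "hemisphere s z \<bullet> hemisphere s z = a\<^sup>2 + b\<^sup>2 + s\<^sup>2 * c\<^sup>2"
    by (simp add: x inner_vec_def sum_3 power2_eq_square algebra_simps)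
  also have "\<dots> = 1" using s c(2) abc by (simp add: algebra_simps power2_eq_square)
  finally have 1: "hemisphere s z \<bullet> hemisphere s z = 1" .
  have "hemisphere s z \<bullet> hemisphere_tangent s z = a - d * (a\<^sup>2 + b\<^sup>2) - s\<^sup>2 * c * a"
    by (simp add: x e inner_vec_def sum_3 power2_eq_square algebra_simps)
  also have "\<dots> = 0" unfolding d2 s by (simp add: algebra_simps)
  finally have 2: "hemisphere s z \<bullet> hemisphere_tangent s z = 0" .
  have "hemisphere_tangent s z \<bullet> hemisphere_tangent s z
      = 1 - 2 * a * d + d * (d * (a\<^sup>2 + b\<^sup>2)) + s\<^sup>2 * a\<^sup>2"
    by (simp add: e inner_vec_def sum_3 power2_eq_square algebra_simps)
  also have "\<dots> = 1 - 2 * a * d + a * d * (1 - c) + a * (d * (1 + c))"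
    unfolding d2 s by (simp add: power2_eq_square flip: ad)
  also have "\<dots> = 1" by (simp add: algebra_simps)
  finally have 3: "hemisphere_tangent s z \<bullet> hemisphere_tangent s z = 1" .
  show ?thesis using 1 2 3 by (simp add: unit_tangent_def norm_eq_1)
qed

text \<open>This is the clutching function of the tangent bundle of the sphere; its degree 2 is the
  Euler characteristic.\<close>

lemma hemisphere_equator:
  assumes "norm z = 1"
  shows "hemisphere (-1) z = hemisphere 1 z"
    and "hemisphere_tangent (-1) z
       = tangent (hemisphere 1 z) (hemisphere_tangent 1 z) (- z\<^sup>2)"
proof -
  show "hemisphere (-1) z = hemisphere 1 z" using assms by (simp add: hemisphere_def)
  obtain a b where z: "z = Complex a b" by (cases z)
  have aa: "a * a = 1 - b * b"
    using assms cmod_power2[of z] by (simp add: z power2_eq_square)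
  \<comment> \<open>A variant of \<open>aa\<close> that also applies inside right-nested
    products.\<close>
  have aat: "a * (a * t) = t - b * (b * t)" for t
    using aa by (metis mult.assoc left_diff_distrib mult_1)
  show "hemisphere_tangent (-1) z
       = tangent (hemisphere 1 z) (hemisphere_tangent 1 z) (- z\<^sup>2)"
    using assms
    by (simp add: hemisphere_def hemisphere_tangent_def tangent_def vec_eq_iff forall_3 cross_components
        power2_eq_square) (simp add: z algebra_simps aa aat)
qed

lemma continuous_on_vector_3 [continuous_intros]:
  fixes f g h :: "'a::t2_space \<Rightarrow> real"
  assumes "continuous_on S f" "continuous_on S g" "continuous_on S h"
  shows "continuous_on S (\<lambda>x. vector [f x, g x, h x] :: real ^ 3)"
  unfolding continuous_on_componentwise[where f = "\<lambda>x. vector [f x, g x, h x] :: real ^ 3"]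
  using assms by (auto simp: Basis_vec_def inner_axis UNIV_3)

lemma continuous_on_hemisphere: "continuous_on S (hemisphere s)"
  unfolding hemisphere_def by (intro continuous_intros)

lemma continuous_on_hemisphere_tangent: "continuous_on (cball 0 1) (hemisphere_tangent s)"
proof -
  have "1 + sqrt (1 - (norm z)\<^sup>2) \<noteq> 0" if "z \<in> cball 0 1" for z :: complex
  proof -
    have "sqrt (1 - (norm z)\<^sup>2) \<ge> 0" using that by (simp add: abs_square_le_1)
    then show ?thesis by linarith
  qed
  then show ?thesis unfolding hemisphere_tangent_def Let_def by (intro continuous_intros) auto
qed

section \<open>Fourier coefficients of the kernel on circles of latitude\<close>

definition latitude_coeff ::
    "(real ^ 3 \<Rightarrow> real ^ 3 \<Rightarrow> real) \<Rightarrow> real \<Rightarrow> nat \<Rightarrow> real ^ 3 \<Rightarrow> real ^ 3 \<Rightarrow> complex" where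
  "latitude_coeff C a m x e = circle_integral (\<lambda>w. of_real (C x (latitude a x e w)) * w ^ m)"

lemma continuous_on_latitude [continuous_intros]:
  fixes x e :: "'a::t2_space \<Rightarrow> real ^ 3"
  assumes "continuous_on S x" "continuous_on S e" "continuous_on S w"
  shows "continuous_on S (\<lambda>z. latitude a (x z) (e z) (w z))"
  unfolding latitude_def tangent_def by (intro continuous_intros continuous_on_cross assms)

context
  fixes C :: "real ^ 3 \<Rightarrow> real ^ 3 \<Rightarrow> real" and a :: real
  assumes contC: "continuous_on (S2 \<times> S2) (\<lambda>(x, y). C x y)" and a: "\<bar>a\<bar> \<le> 1"
begin

lemma continuous_on_kernel_latitude:
  fixes x e :: "'a::t2_space \<Rightarrow> real ^ 3"
  assumes "continuous_on S x" "continuous_on S e" "continuous_on S w"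
    and "\<And>z. z \<in> S \<Longrightarrow> unit_tangent (x z) (e z)" "\<And>z. z \<in> S \<Longrightarrow> norm (w z) = 1"
  shows "continuous_on S (\<lambda>z. C (x z) (latitude a (x z) (e z) (w z)))"
proof -
  have "continuous_on S (\<lambda>z. (\<lambda>(x, y). C x y) (x z, latitude a (x z) (e z) (w z)))"
    by (rule continuous_on_compose2[OF contC])
      (use assms latitude_in_S2 a in \<open>auto intro!: continuous_intros simp: unit_tangent_def\<close>)
  then show ?thesis by simp
qed

text \<open>Turning the frame by \<open>\<zeta>\<close> substitutes \<open>w * \<zeta>\<close> for
  \<open>w\<close> in the kernel; the rotated monomial \<open>w ^ m\<close> contributes the
  factor.\<close>

lemma latitude_coeff_tangent:
  assumes xe: "unit_tangent x e" and \<zeta>: "norm \<zeta> = 1"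
  shows "latitude_coeff C a m x e = \<zeta> ^ m * latitude_coeff C a m x (tangent x e \<zeta>)"
proof -
  let ?h = "\<lambda>w. of_real (C x (latitude a x e w)) * w ^ m :: complex"
  have "continuous_on (sphere 0 1) ?h"
    using xe by (intro continuous_intros continuous_on_kernel_latitude) auto
  then have "latitude_coeff C a m x e = circle_integral (\<lambda>w. ?h (w * \<zeta>))"
    unfolding latitude_coeff_def using \<zeta> by (rule circle_integral_rotate[symmetric])
  also have "\<dots> = circle_integral
      (\<lambda>w. \<zeta> ^ m * (of_real (C x (latitude a x (tangent x e \<zeta>) w)) * w ^ m))"
    by (simp add: latitude_tangent[OF xe] power_mult_distrib mult_ac)
  finally show ?thesis by (simp only: circle_integral_mult_left latitude_coeff_def)
qed

text \<open>The rotation from \<open>x\<close> to \<open>y\<close> carries circles about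
  \<open>x\<close> to circles about \<open>y\<close> and preserves the coefficient. The transported
  frame differs from \<open>f\<close> only by a unit complex number.\<close>

lemma norm_latitude_coeff_eq:
  assumes inv: "rotationally_invariant C"
    and xe: "unit_tangent x e" and ye: "unit_tangent y f"
  shows "norm (latitude_coeff C a m x e) = norm (latitude_coeff C a m y f)"
proof -
  have "x \<in> S2" "y \<in> S2" using xe ye by (auto simp: unit_tangent_def)
  then obtain R where R: "R \<in> SO3" "R *v x = y" "\<And>z. z \<in> S2 \<Longrightarrow> C x z = C y (R *v z)"
    using inv unfolding rotationally_invariant_def by metis
  have "latitude_coeff C a m x e = latitude_coeff C a m y (R *v e)"
    unfolding latitude_coeff_def
  proof (rule circle_integral_cong)
    fix w :: complex assume "norm w = 1"
    then have "latitude a x e w \<in> S2" using latitude_in_S2 xe a by blast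
    then show "of_real (C x (latitude a x e w)) * w ^ m
        = of_real (C y (latitude a y (R *v e) w)) * w ^ m"
      using R by (simp add: latitude_rotation)
  qed
  moreover obtain \<zeta> where \<zeta>: "norm \<zeta> = 1" "R *v e = tangent y f \<zeta>"
    using ex_unit_tangent_rotation[OF ye] unit_tangent_rotation[OF R(1) xe] R(2) by metis
  ultimately show ?thesis
    using latitude_coeff_tangent[OF ye \<zeta>(1), of m] by (simp add: norm_mult norm_power)
qed

lemma continuous_on_latitude_coeff:
  fixes x e :: "'a::t2_space \<Rightarrow> real ^ 3"
  assumes "continuous_on S x" "continuous_on S e"
    and "\<And>z. z \<in> S \<Longrightarrow> unit_tangent (x z) (e z)"
  shows "continuous_on S (\<lambda>z. latitude_coeff C a m (x z) (e z))"
proof -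
  \<comment> \<open>Joint continuity in the parameter and the angle gives continuity of the integral
    over the angle.\<close>
  have "continuous_on (S \<times> cbox 0 (2 * pi))
     (\<lambda>p. complex_of_real (C (x (fst p)) (latitude a (x (fst p)) (e (fst p)) (cis (snd p))))
        * cis (snd p) ^ m)"
    using assms
    by (intro continuous_intros continuous_on_kernel_latitude
        continuous_on_compose2[OF assms(1) continuous_on_fst[OF continuous_on_id]]
        continuous_on_compose2[OF assms(2) continuous_on_fst[OF continuous_on_id]]) auto
  then have "continuous_on (S \<times> cbox 0 (2 * pi))
     (\<lambda>(z, t). complex_of_real (C (x z) (latitude a (x z) (e z) (cis t))) * cis t ^ m)"
    by (simp add: case_prod_unfold)
  from integral_continuous_on_param[OF this] show ?thesis
    by (simp add: latitude_coeff_def circle_integral_def)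
qed

lemma latitude_coeff_eq_0:
  assumes inv: "rotationally_invariant C" and m: "m > 0" and xe: "unit_tangent x e"
  shows "latitude_coeff C a m x e = 0"
proof (rule ccontr)
  assume nz: "latitude_coeff C a m x e \<noteq> 0"
  let ?F = "\<lambda>s z. latitude_coeff C a m (hemisphere s z) (hemisphere_tangent s z)"
  have cont: "continuous_on (cball 0 1) (?F s)" and nz': "\<And>z. z \<in> cball 0 1 \<Longrightarrow> ?F s z \<noteq> 0"
    if s: "s\<^sup>2 = 1" for s
  proof -
    have ut: "unit_tangent (hemisphere s z) (hemisphere_tangent s z)" if "z \<in> cball 0 1" for z
      using unit_tangent_hemisphere[OF s] that by simp
    show "continuous_on (cball 0 1) (?F s)"
      using ut by (intro continuous_on_latitude_coeff continuous_on_hemisphere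
          continuous_on_hemisphere_tangent)
    fix z :: complex assume "z \<in> cball 0 1"
    then show "?F s z \<noteq> 0"
      using norm_latitude_coeff_eq[OF inv xe ut, of z m] nz by auto
  qed
  \<comment> \<open>On the equator the frames differ by \<open>- z\<^sup>2\<close>, whose
    \<open>m\<close>-th power has winding number 2 * m, positive because
    \<open>m > 0\<close>.\<close>
  have "?F 1 z = (-1) ^ m * z ^ (2 * m) * ?F (-1) z" if z: "norm z = 1" for z
  proof -
    have "?F 1 z = (- z\<^sup>2) ^ m * ?F (-1) z"
      unfolding hemisphere_equator[OF z]
      by (rule latitude_coeff_tangent) (use z in \<open>auto simp: unit_tangent_hemisphere norm_power\<close>)
    also have "(- z\<^sup>2) ^ m = (-1) ^ m * z ^ (2 * m)"
      by (subst power_minus) (simp add: power_mult)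
    finally show ?thesis .
  qed
  then show False
    using power_not_nonvanishing_extension[of "?F 1" "?F (-1)" "(-1) ^ m" "2 * m"] cont nz' m by auto
qed

end

section \<open>From constancy on latitudes to isotropy\<close>

lemma ex_unit_tangent:
  assumes "x \<in> S2"
  obtains e where "unit_tangent x e"
proof -
  obtain y where y: "y \<noteq> 0" "orthogonal x y"
    using orthogonal_to_vector_exists[of x] by auto
  then have "unit_tangent x (y /\<^sub>R norm y)"
    using assms by (simp add: unit_tangent_def orthogonal_def)
  then show ?thesis using that by blast
qed

text \<open>Both points lie on the circle about \<open>x\<close> of height
  \<open>x \<bullet> y\<close>, where all coefficients of positive index of the real function
  \<open>C x\<close> vanish.\<close>

lemma rotationally_invariant_imp_constant_on_latitudes:
  assumes contC: "continuous_on (S2 \<times> S2) (\<lambda>(x, y). C x y)"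
    and inv: "rotationally_invariant C"
    and S2: "x \<in> S2" "y \<in> S2" "y' \<in> S2"
    and eq: "x \<bullet> y = x \<bullet> y'"
  shows "C x y = C x y'"
proof -
  let ?a = "x \<bullet> y"
  have a: "\<bar>?a\<bar> \<le> 1" using Cauchy_Schwarz_ineq2[of x y] S2 by simp
  obtain e where xe: "unit_tangent x e" using ex_unit_tangent[OF S2(1)] .
  have "continuous_on (sphere 0 1) (\<lambda>w. C x (latitude ?a x e w))"
    using xe by (intro continuous_on_kernel_latitude[OF contC a] continuous_intros) auto
  then have "(\<lambda>w. C x (latitude ?a x e w)) constant_on sphere 0 1"
  proof (rule constant_on_circle_if_fourier_vanish)
    fix m :: nat assume "m > 0"
    then show "circle_integral (\<lambda>w. of_real (C x (latitude ?a x e w)) * w ^ m) = 0"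
      using latitude_coeff_eq_0[OF contC a inv _ xe] by (simp add: latitude_coeff_def)
  qed
  then obtain c where c: "\<And>w. norm w = 1 \<Longrightarrow> C x (latitude ?a x e w) = c"
    unfolding constant_on_def by auto
  obtain w w' where "norm w = 1" "y = latitude ?a x e w" "norm w' = 1" "y' = latitude ?a x e w'"
    using in_latitude[OF xe] S2 eq by metis
  then show ?thesis using c by metis
qed

theorem theorem1:
  fixes M :: "'w measure" and T :: "real ^ 3 \<Rightarrow> 'w \<Rightarrow> real"
  assumes "spherical_random_field M T"
    and "anisotropic M T"
  shows "\<not> rotationally_invariant (covariance_function M T)"
proof
  let ?C = "covariance_function M T"
  assume inv: "rotationally_invariant ?C"
  note contC = spherical_random_field.continuous_covariance[OF assms(1)]
  have "?C (R *v x) (R *v y) = ?C x y" if R: "R \<in> SO3" and x: "x \<in> S2" and y: "y \<in> S2" for R x y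
  proof -
    have S2: "Q *v z \<in> S2" if "Q \<in> SO3" "z \<in> S2" for Q z
      using that inner_rotation[of Q z z] by (simp add: norm_eq_1)
    \<comment> \<open>Invariance supplies some \<open>Q\<close> in place of the given
      \<open>R\<close>. As both preserve inner products, \<open>Q *v y\<close> and
      \<open>R *v y\<close> lie on the same latitude about \<open>R *v x\<close>, where the kernel
      is constant.\<close>
    obtain Q where Q: "Q \<in> SO3" "Q *v x = R *v x" "?C x y = ?C (Q *v x) (Q *v y)"
      using inv x y S2[OF R x] unfolding rotationally_invariant_def by metis
    have "(R *v x) \<bullet> (R *v y) = (R *v x) \<bullet> (Q *v y)"
      using inner_rotation[OF R, of x y] inner_rotation[OF Q(1), of x y] Q(2) by simp
    then have "?C (R *v x) (R *v y) = ?C (R *v x) (Q *v y)"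
      using rotationally_invariant_imp_constant_on_latitudes[OF contC inv] S2 R Q(1) x y by blast
    with Q show ?thesis by simp
  qed
  with assms(2) show False by (simp add: isotropic_def)
qed

end
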